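(* Let $G$ be a finitely presented virtually abelian group (that is, $G$ has an abelian subgroup of finite index). Then $G$ is $\mathrm{Coset}$-generalized conjugacy separable: for every finitely generated subgroup $H\leq G$ and every $g\in G$, the set $\alpha(Hg)=\{x^{-1}sx\mid x\in G,\ s\in Hg\}$ is closed in the profinite topology of $G$.
   Context: The profinite topology on a group $G$ has as basis the cosets of finite index subgroups of $G$. *)

theory Defs
  imports "HOL-Algebra.Generated_Groups" "HOL-Analysis.Abstract_Topology"
begin

section \<open>Free groups and finite presentations\<close>

text \<open>
  A word over \<open>X\<close> is a list of letters \<open>(x, b)\<close> with \<open>x \<in> X\<close>, where \<open>(x, True)\<close> stands for
  \<open>x\<close> and \<open>(x, False)\<close> for \<open>x\<^sup>-\<^sup>1\<close>. The free group on \<open>X\<close> consists of the words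
  modulo insertion and deletion of adjacent mutually inverse letters.
\<close>

inductive free_eq :: "'x set \<Rightarrow> ('x \<times> bool) list \<Rightarrow> ('x \<times> bool) list \<Rightarrow> bool"
  for X :: "'x set" where
  refl: "w \<in> lists (X \<times> UNIV) \<Longrightarrow> free_eq X w w"
| cancel: "\<lbrakk>u \<in> lists (X \<times> UNIV); v \<in> lists (X \<times> UNIV); x \<in> X\<rbrakk>
    \<Longrightarrow> free_eq X (u @ [(x, b), (x, \<not> b)] @ v) (u @ v)"
| sym: "free_eq X u v \<Longrightarrow> free_eq X v u"
| trans: "\<lbrakk>free_eq X u v; free_eq X v w\<rbrakk> \<Longrightarrow> free_eq X u w"

definition free_rel :: "'x set \<Rightarrow> (('x \<times> bool) list \<times> ('x \<times> bool) list) set"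
  where "free_rel X = {(u, v). free_eq X u v}"

definition free_group :: "'x set \<Rightarrow> ('x \<times> bool) list set monoid"
  where "free_group X =
    \<lparr>carrier = lists (X \<times> UNIV) // free_rel X,
     mult = (\<lambda>A B. \<Union>a\<in>A. \<Union>b\<in>B. free_rel X `` {a @ b}),
     one = free_rel X `` {[]}\<rparr>"

definition normal_closure :: "('a, 'b) monoid_scheme \<Rightarrow> 'a set \<Rightarrow> 'a set"
  where "normal_closure G R = \<Inter>{N. N \<lhd> G \<and> R \<subseteq> N}"

text \<open>
  Any finite generating set may be renamed to a finite set of natural numbers.
\<close>

definition finitely_presented :: "('a, 'b) monoid_scheme \<Rightarrow> bool"
  where "finitely_presented G \<longleftrightarrow>
    (\<exists>(X :: nat set) R. finite X \<and> finite R \<and> R \<subseteq> carrier (free_group X) \<and>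
       G \<cong> free_group X Mod normal_closure (free_group X) R)"

lemma free_eq_words:
  "free_eq X u v \<Longrightarrow> u \<in> lists (X \<times> UNIV) \<and> v \<in> lists (X \<times> UNIV)"
  by (induction rule: free_eq.induct) auto

lemma equiv_free_rel: "equiv (lists (X \<times> UNIV)) (free_rel X)"
proof (rule equivI)
  show "free_rel X \<subseteq> lists (X \<times> UNIV) \<times> lists (X \<times> UNIV)"
    using free_eq_words by (fastforce simp: free_rel_def)
  show "refl_on (lists (X \<times> UNIV)) (free_rel X)"
    unfolding refl_on_def free_rel_def using free_eq.refl by blast
  show "sym (free_rel X)"
    unfolding sym_def free_rel_def using free_eq.sym by blast
  show "trans (free_rel X)"
    unfolding trans_def free_rel_def using free_eq.trans by blast
qed

lemma free_eq_append_right: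
  assumes "free_eq X u v" "w \<in> lists (X \<times> UNIV)"
  shows "free_eq X (u @ w) (v @ w)"
  using assms(1)
proof (induction rule: free_eq.induct)
  case (refl w')
  then show ?case using assms(2) by (intro free_eq.refl) auto
next
  case (cancel u v x b)
  then show ?case using free_eq.cancel[of u X "v @ w" x b] assms(2) by auto
qed (blast intro: free_eq.sym free_eq.trans)+

lemma free_eq_append_left:
  assumes "free_eq X u v" "w \<in> lists (X \<times> UNIV)"
  shows "free_eq X (w @ u) (w @ v)"
  using assms(1)
proof (induction rule: free_eq.induct)
  case (refl w')
  then show ?case using assms(2) by (intro free_eq.refl) auto
next
  case (cancel u v x b)
  then show ?case using free_eq.cancel[of "w @ u" X v x b] assms(2) by auto
qed (blast intro: free_eq.sym free_eq.trans)+

lemma free_eq_append: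
  assumes "free_eq X u u'" "free_eq X v v'"
  shows "free_eq X (u @ v) (u' @ v')"
  by (meson assms free_eq.trans free_eq_append_left free_eq_append_right free_eq_words)

lemma free_group_mult_class:
  assumes "u \<in> lists (X \<times> UNIV)" "v \<in> lists (X \<times> UNIV)"
  shows "free_rel X `` {u} \<otimes>\<^bsub>free_group X\<^esub> free_rel X `` {v} = free_rel X `` {u @ v}"
proof -
  have "free_rel X `` {a @ b} = free_rel X `` {u @ v}"
    if "a \<in> free_rel X `` {u}" "b \<in> free_rel X `` {v}" for a b
  proof -
    have "free_eq X (u @ v) (a @ b)"
      using that free_eq_append by (auto simp: free_rel_def)
    then show ?thesis
      by (metis (mono_tags, lifting) CollectI case_prodI equiv_class_eq equiv_free_rel free_rel_def)
  qed
  moreover have "u \<in> free_rel X `` {u}" "v \<in> free_rel X `` {v}"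
    using assms free_eq.refl by (auto simp: free_rel_def)
  ultimately have "(\<Union>a\<in>free_rel X `` {u}. \<Union>b\<in>free_rel X `` {v}. free_rel X `` {a @ b})
      = free_rel X `` {u @ v}"
    by blast
  then show ?thesis
    by (simp add: free_group_def)
qed

lemma free_eq_inverse:
  assumes "w \<in> lists (X \<times> UNIV)"
  shows "free_eq X (rev (map (\<lambda>(x, b). (x, \<not> b)) w) @ w) []"
  using assms
proof (induction w rule: list.induct)
  case Nil
  then show ?case by (simp add: free_eq.refl)
next
  case (Cons l w)
  obtain x b where l: "l = (x, b)" by (cases l)
  let ?i = "rev (map (\<lambda>(x, b). (x, \<not> b)) w)"
  have "?i \<in> lists (X \<times> UNIV)" "w \<in> lists (X \<times> UNIV)" "x \<in> X"
    using Cons.prems l by auto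
  then have "free_eq X (?i @ [(x, \<not> b), (x, \<not> \<not> b)] @ w) (?i @ w)"
    by (intro free_eq.cancel)
  moreover have "free_eq X (?i @ w) []"
    using Cons.IH Cons.prems by simp
  ultimately have "free_eq X (?i @ [(x, \<not> b), (x, \<not> \<not> b)] @ w) []"
    by (rule free_eq.trans)
  then show ?case
    using l by simp
qed

lemma group_free_group: "group (free_group X)"
proof (rule groupI)
  have carr: "\<exists>u\<in>lists (X \<times> UNIV). A = free_rel X `` {u}" if "A \<in> carrier (free_group X)" for A
    using that by (auto simp: free_group_def quotient_def)
  have cls: "free_rel X `` {u} \<in> carrier (free_group X)" if "u \<in> lists (X \<times> UNIV)" for u
    using that by (auto simp: free_group_def quotient_def)
  have one: "\<one>\<^bsub>free_group X\<^esub> = free_rel X `` {[]}"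
    by (simp add: free_group_def)
  show "\<one>\<^bsub>free_group X\<^esub> \<in> carrier (free_group X)"
    using cls one by simp
  show "A \<otimes>\<^bsub>free_group X\<^esub> B \<in> carrier (free_group X)"
    if AB: "A \<in> carrier (free_group X)" "B \<in> carrier (free_group X)" for A B
  proof -
    obtain u v where "u \<in> lists (X \<times> UNIV)" "A = free_rel X `` {u}"
      "v \<in> lists (X \<times> UNIV)" "B = free_rel X `` {v}"
      using carr[OF AB(1)] carr[OF AB(2)] by blast
    then show ?thesis
      by (simp add: free_group_mult_class cls del: in_lists_conv_set)
  qed
  show "A \<otimes>\<^bsub>free_group X\<^esub> B \<otimes>\<^bsub>free_group X\<^esub> C
      = A \<otimes>\<^bsub>free_group X\<^esub> (B \<otimes>\<^bsub>free_group X\<^esub> C)"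
    if ABC: "A \<in> carrier (free_group X)" "B \<in> carrier (free_group X)"
      "C \<in> carrier (free_group X)"
    for A B C
  proof -
    obtain u v w where "u \<in> lists (X \<times> UNIV)" "A = free_rel X `` {u}"
      "v \<in> lists (X \<times> UNIV)" "B = free_rel X `` {v}"
      "w \<in> lists (X \<times> UNIV)" "C = free_rel X `` {w}"
      using carr[OF ABC(1)] carr[OF ABC(2)] carr[OF ABC(3)] by blast
    then show ?thesis
      by (simp add: free_group_mult_class del: in_lists_conv_set)
  qed
  show "\<one>\<^bsub>free_group X\<^esub> \<otimes>\<^bsub>free_group X\<^esub> A = A"
    if A: "A \<in> carrier (free_group X)" for A
  proof -
    obtain u where "u \<in> lists (X \<times> UNIV)" "A = free_rel X `` {u}"
      using carr[OF A] by blast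
    then show ?thesis
      using free_group_mult_class[OF lists.Nil] by (simp add: one del: in_lists_conv_set)
  qed
  show "\<exists>B\<in>carrier (free_group X). B \<otimes>\<^bsub>free_group X\<^esub> A = \<one>\<^bsub>free_group X\<^esub>"
    if A: "A \<in> carrier (free_group X)" for A
  proof -
    obtain u where u: "u \<in> lists (X \<times> UNIV)" "A = free_rel X `` {u}"
      using carr[OF A] by blast
    let ?v = "rev (map (\<lambda>(x, b). (x, \<not> b)) u)"
    have v: "?v \<in> lists (X \<times> UNIV)" using u(1) by auto
    have "(?v @ u, []) \<in> free_rel X"
      using free_eq_inverse[OF u(1)] by (simp add: free_rel_def)
    then have "free_rel X `` {?v @ u} = free_rel X `` {[]}"
      by (rule equiv_class_eq[OF equiv_free_rel])
    then have "free_rel X `` {?v} \<otimes>\<^bsub>free_group X\<^esub> A = \<one>\<^bsub>free_group X\<^esub>"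
      unfolding u(2) one free_group_mult_class[OF v u(1)] .
    then show ?thesis
      using cls[OF v] by blast
  qed
qed

lemma (in group) normal_normal_closure:
  assumes "R \<subseteq> carrier G"
  shows "normal_closure G R \<lhd> G"
proof -
  let ?F = "{N. N \<lhd> G \<and> R \<subseteq> N}"
  have "carrier G \<lhd> G"
    by (rule normal_invI) (auto simp: subgroup_self)
  then have ne: "?F \<noteq> {}" using assms by blast
  have "subgroup (\<Inter>?F) G"
    by (rule subgroups_Inter) (use ne in \<open>auto simp: normal_imp_subgroup\<close>)
  then show ?thesis
    unfolding normal_closure_def
    by (rule normal_invI) (auto simp: normal_inv_iff)
qed


section \<open>Finitely generated subgroups, finite index, profinite topology\<close>

definition fg_subgroup :: "'a set \<Rightarrow> ('a, 'b) monoid_scheme \<Rightarrow> bool"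
  where "fg_subgroup H G \<longleftrightarrow>
    subgroup H G \<and> (\<exists>S. finite S \<and> S \<subseteq> carrier G \<and> H = generate G S)"

definition finite_index_subgroup :: "'a set \<Rightarrow> ('a, 'b) monoid_scheme \<Rightarrow> bool"
  where "finite_index_subgroup K G \<longleftrightarrow> subgroup K G \<and> finite (rcosets\<^bsub>G\<^esub> K)"

definition virtually_abelian :: "('a, 'b) monoid_scheme \<Rightarrow> bool"
  where "virtually_abelian G \<longleftrightarrow>
    (\<exists>A. finite_index_subgroup A G \<and> comm_group (G\<lparr>carrier := A\<rparr>))"

text \<open>
  Right cosets suffice: the left coset \<open>gK\<close> is the right coset \<open>(gKg\<^sup>-\<^sup>1)g\<close> of a conjugate
  subgroup of the same index.
\<close>

definition finite_index_coset :: "('a, 'b) monoid_scheme \<Rightarrow> 'a set \<Rightarrow> bool"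
  where "finite_index_coset G U \<longleftrightarrow>
    (\<exists>K g. finite_index_subgroup K G \<and> g \<in> carrier G \<and> U = K #>\<^bsub>G\<^esub> g)"

definition profinite_topology :: "('a, 'b) monoid_scheme \<Rightarrow> 'a topology"
  where "profinite_topology G = topology (arbitrary union_of (finite_index_coset G))"

lemma (in group) r_coset_Int:
  assumes "subgroup K G" "subgroup L G" "x \<in> carrier G"
  shows "(K \<inter> L) #> x = (K #> x) \<inter> (L #> x)"
proof -
  have "k \<in> L" if "k \<in> K" "l \<in> L" "k \<otimes> x = l \<otimes> x" for k l
    using that assms by (metis right_cancel subgroup.mem_carrier)
  then show ?thesis
    unfolding r_coset_def by auto
qed

lemma (in group) finite_index_subgroup_Int:
  assumes "finite_index_subgroup K G" "finite_index_subgroup L G"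
  shows "finite_index_subgroup (K \<inter> L) G"
proof -
  have K: "subgroup K G" and L: "subgroup L G"
    using assms by (auto simp: finite_index_subgroup_def)
  have "rcosets (K \<inter> L) \<subseteq> (\<lambda>(A, B). A \<inter> B) ` ((rcosets K) \<times> (rcosets L))"
    using r_coset_Int[OF K L] by (fastforce simp: RCOSETS_def)
  moreover have "finite ((rcosets K) \<times> (rcosets L))"
    using assms by (simp add: finite_index_subgroup_def)
  ultimately have "finite (rcosets (K \<inter> L))"
    by (meson finite_imageI finite_subset)
  then show ?thesis
    using subgroups_Inter_pair[OF K L] by (simp add: finite_index_subgroup_def)
qed

lemma (in group) istopology_profinite:
  "istopology (arbitrary union_of (finite_index_coset G))"
  unfolding istopology_base_eq
proof (intro allI impI)
  fix S T assume "finite_index_coset G S \<and> finite_index_coset G T"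
  then obtain K g L h where
    K: "finite_index_subgroup K G" "g \<in> carrier G" "S = K #> g" and
    L: "finite_index_subgroup L G" "h \<in> carrier G" "T = L #> h"
    unfolding finite_index_coset_def by auto
  have sK: "subgroup K G" and sL: "subgroup L G"
    using K L by (auto simp: finite_index_subgroup_def)
  show "(arbitrary union_of (finite_index_coset G)) (S \<inter> T)"
  proof (cases "S \<inter> T = {}")
    case True
    then show ?thesis by simp
  next
    case False
    then obtain x where x: "x \<in> S" "x \<in> T" by auto
    then have xG: "x \<in> carrier G"
      using K(2,3) sK by (meson r_coset_subset_G subgroup.subset subsetD)
    have "S \<inter> T = (K \<inter> L) #> x"
      using x K(2,3) L(2,3) sK sL xG r_coset_Int repr_independence by metis
    then have "finite_index_coset G (S \<inter> T)"
      using finite_index_subgroup_Int[OF K(1) L(1)] xG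
      unfolding finite_index_coset_def by blast
    then show ?thesis
      by (simp add: arbitrary_def union_of_inc)
  qed
qed

lemma (in group) openin_profinite:
  "openin (profinite_topology G) = arbitrary union_of (finite_index_coset G)"
  unfolding profinite_topology_def using istopology_profinite topology_inverse' by blast

lemma (in group) topspace_profinite: "topspace (profinite_topology G) = carrier G"
proof
  have "finite_index_coset G U \<Longrightarrow> U \<subseteq> carrier G" for U
    unfolding finite_index_coset_def finite_index_subgroup_def
    using r_coset_subset_G subgroup.subset by metis
  then show "topspace (profinite_topology G) \<subseteq> carrier G"
    unfolding topspace_def openin_profinite union_of_def by blast
  have "rcosets (carrier G) \<subseteq> {carrier G}"
    unfolding RCOSETS_def using coset_join2 subgroup_self by blast
  then have "finite_index_subgroup (carrier G) G"
    unfolding finite_index_subgroup_def using finite_subset subgroup_self by blast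
  then have "finite_index_coset G (carrier G)"
    unfolding finite_index_coset_def
    by (metis coset_join2 one_closed subgroup_self)
  then have "openin (profinite_topology G) (carrier G)"
    unfolding openin_profinite by (simp add: arbitrary_def union_of_inc)
  then show "carrier G \<subseteq> topspace (profinite_topology G)"
    by (rule openin_subset)
qed


section \<open>Coset-generalized conjugacy separability\<close>

definition conj_saturation :: "('a, 'b) monoid_scheme \<Rightarrow> 'a set \<Rightarrow> 'a set"
  where "conj_saturation G S =
    {inv\<^bsub>G\<^esub> x \<otimes>\<^bsub>G\<^esub> s \<otimes>\<^bsub>G\<^esub> x | x s. x \<in> carrier G \<and> s \<in> S}"

definition coset_gen_conj_separable :: "('a, 'b) monoid_scheme \<Rightarrow> bool"
  where "coset_gen_conj_separable G \<longleftrightarrow>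
    (\<forall>H g. fg_subgroup H G \<and> g \<in> carrier G \<longrightarrow>
       closedin (profinite_topology G) (conj_saturation G (H #>\<^bsub>G\<^esub> g)))"

end

theory Submission
  imports Defs
begin

text \<open>
  Let \<open>A\<close> be an abelian normal subgroup of finite index in \<open>G\<close>. Conjugating by an element \<open>a\<close> of \<open>A\<close>
  turns \<open>m v\<close>, for \<open>m \<in> A\<close> and \<open>v \<in> G\<close>, into
  \<open>a\<^sup>-\<^sup>1 (m v) a = m (a\<^sup>-\<^sup>1 \<cdot> v a v\<^sup>-\<^sup>1) v\<close>.
  Since \<open>A\<close> is abelian, \<open>a \<mapsto> a\<^sup>-\<^sup>1 \<cdot> v a v\<^sup>-\<^sup>1\<close> is an endomorphism of \<open>A\<close>, so if \<open>m\<close> ranges over a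
  subgroup \<open>M\<close> of \<open>A\<close> and \<open>a\<close> over \<open>A\<close>, these conjugates fill exactly one coset \<open>L v\<close> of a subgroup
  \<open>L\<close> of \<open>A\<close> (\<open>conjugates_of_coset_form_coset\<close>). A coset \<open>H g\<close> is a finite union of cosets of \<open>H \<inter> A\<close>,
  and a conjugation in \<open>G\<close> is one of finitely many conjugations followed by a conjugation by an
  element of \<open>A\<close>. Hence the saturation of \<open>H g\<close> under conjugation is a finite union of cosets of
  subgroups of \<open>A\<close> (\<open>conj_saturation_decomposition\<close>).

  It remains to see that such cosets are closed, that is, that every subgroup \<open>L\<close> of \<open>A\<close> is an
  intersection of finite-index subgroups of \<open>G\<close>. The group \<open>A\<close> is finitely generated, by Schreier's
  argument (\<open>fg_finite_index_subgroup\<close>). Given \<open>x \<in> A - L\<close>, choose a subgroup \<open>N\<close> of \<open>A\<close> that is maximal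
  among those containing \<open>L\<close> but not \<open>x\<close>. Every nontrivial subgroup of \<open>A/N\<close> contains the image of
  \<open>x\<close>; no infinite cyclic group has such an element, so \<open>A/N\<close> is a torsion group, and being finitely
  generated and abelian it is finite (\<open>fg_abelian_subgroup_separable\<close>).
\<close>

section \<open>Finite-index subgroups\<close>

text \<open>
  Coverings by finitely many cosets multiply in towers and restrict to subgroups more readily than
  the set of cosets does.
\<close>

lemma (in group) finite_index_iff_finite_cover:
  assumes "subgroup K G"
  shows "finite_index_subgroup K G \<longleftrightarrow>
    (\<exists>F. finite F \<and> F \<subseteq> carrier G \<and> carrier G \<subseteq> K <#> F)"
proof
  assume "finite_index_subgroup K G"
  then have "finite ((\<lambda>x. K #> x) ` carrier G)"
    by (simp add: finite_index_subgroup_def RCOSETS_def UNION_singleton_eq_range)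
  then obtain F where F: "F \<subseteq> carrier G" "finite F"
    "(\<lambda>x. K #> x) ` carrier G = (\<lambda>x. K #> x) ` F"
    using finite_subset_image[OF _ order_refl] by metis
  have "x \<in> K <#> F" if x: "x \<in> carrier G" for x
  proof -
    obtain f where "f \<in> F" "K #> x = K #> f"
      using F(3) x by blast
    then have "x \<in> K #> f"
      using rcos_self[OF x assms] by simp
    then show ?thesis
      using \<open>f \<in> F\<close> by (auto simp: set_mult_def r_coset_def)
  qed
  then show "\<exists>F. finite F \<and> F \<subseteq> carrier G \<and> carrier G \<subseteq> K <#> F"
    using F by blast
next
  assume "\<exists>F. finite F \<and> F \<subseteq> carrier G \<and> carrier G \<subseteq> K <#> F"
  then obtain F where F: "finite F" "F \<subseteq> carrier G" "carrier G \<subseteq> K <#> F"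
    by blast
  have "K #> x \<in> (\<lambda>f. K #> f) ` F" if x: "x \<in> carrier G" for x
  proof -
    obtain f where "f \<in> F" "x \<in> K #> f"
      using subsetD[OF F(3) x] by (auto simp: set_mult_def r_coset_def)
    then show ?thesis
      using repr_independence[of x K f] F(2) assms by blast
  qed
  then have "rcosets K \<subseteq> (\<lambda>f. K #> f) ` F"
    by (auto simp: RCOSETS_def)
  then show "finite_index_subgroup K G"
    using F(1) assms finite_subset[of "rcosets K"] by (simp add: finite_index_subgroup_def)
qed

lemma (in group) finite_index_subgroup_trans:
  assumes A: "finite_index_subgroup A G"
    and N: "finite_index_subgroup N (G\<lparr>carrier := A\<rparr>)"
  shows "finite_index_subgroup N G"
proof -
  have sA: "subgroup A G"
    using A by (simp add: finite_index_subgroup_def)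
  interpret A: group "G\<lparr>carrier := A\<rparr>"
    using sA by (rule subgroup_imp_group)
  have sN: "subgroup N (G\<lparr>carrier := A\<rparr>)"
    using N by (simp add: finite_index_subgroup_def)
  have sNG: "subgroup N G"
    using incl_subgroup[OF sA sN] .
  obtain F where F: "finite F" "F \<subseteq> carrier G" "carrier G \<subseteq> A <#> F"
    using A finite_index_iff_finite_cover[OF sA] by blast
  obtain E where E: "finite E" "E \<subseteq> A" "A \<subseteq> N <#> E"
    using N A.finite_index_iff_finite_cover[OF sN] by auto
  have EG: "E \<subseteq> carrier G"
    using E(2) sA subgroup.subset by blast
  have "carrier G \<subseteq> (N <#> E) <#> F"
    using F(3) mono_set_mult[OF E(3) order_refl, where G=G] by blast
  also have "\<dots> = N <#> (E <#> F)"
    using set_mult_assoc[OF subgroup.subset[OF sNG] EG F(2)] .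
  finally have "carrier G \<subseteq> N <#> (E <#> F)" .
  moreover have "finite (E <#> F)"
    using E(1) F(1) by (simp add: set_mult_def)
  moreover have "E <#> F \<subseteq> carrier G"
    using EG F(2) by (rule set_mult_closed)
  ultimately show ?thesis
    using finite_index_iff_finite_cover[OF sNG] by blast
qed

text \<open>
  Two elements of \<open>H\<close> in the same coset of \<open>A\<close> are in the same coset of \<open>H \<inter> A\<close>, so one element of
  \<open>H\<close> for each coset of \<open>A\<close> that meets \<open>H\<close> suffices.
\<close>

lemma (in group) finite_cover_subgroup_Int:
  assumes A: "finite_index_subgroup A G" and H: "subgroup H G"
  obtains F where "finite F" "F \<subseteq> H" "H \<subseteq> (H \<inter> A) <#> F"
proof -
  have sA: "subgroup A G"
    using A by (simp add: finite_index_subgroup_def)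
  have "finite ((\<lambda>x. A #> x) ` H)"
  proof (rule finite_subset)
    show "(\<lambda>x. A #> x) ` H \<subseteq> rcosets A"
      using subgroup.subset[OF H] by (auto simp: RCOSETS_def)
    show "finite (rcosets A)"
      using A by (simp add: finite_index_subgroup_def)
  qed
  then obtain F where F: "F \<subseteq> H" "finite F" "(\<lambda>x. A #> x) ` H = (\<lambda>x. A #> x) ` F"
    using finite_subset_image[OF _ order_refl] by metis
  have "x \<in> (H \<inter> A) <#> F" if x: "x \<in> H" for x
  proof -
    obtain f where f: "f \<in> F" "A #> x = A #> f"
      using F(3) x by blast
    have fH: "f \<in> H" using f(1) F(1) by blast
    have xG: "x \<in> carrier G" and fG: "f \<in> carrier G"
      using x fH H by (auto intro: subgroup.mem_carrier)
    obtain a where a: "a \<in> A" "x = a \<otimes> f"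
      using rcos_self[OF xG sA] f(2) by (auto simp: r_coset_def)
    have "a = x \<otimes> inv f"
      using a fG subgroup.mem_carrier[OF sA] by (simp add: inv_solve_right)
    then have "a \<in> H"
      using x fH H by (simp add: subgroup.m_closed subgroup.m_inv_closed)
    then show ?thesis
      using a f(1) by (auto simp: set_mult_def)
  qed
  then have "H \<subseteq> (H \<inter> A) <#> F" by blast
  then show thesis
    by (rule that[OF F(2,1)])
qed

text \<open>
  The intersection of all conjugates of \<open>A\<close> is the kernel of the action of \<open>G\<close> on the finite set of
  cosets of \<open>A\<close> by right multiplication. Its index is finite because that set has only finitely many
  permutations.
\<close>

lemma (in group) finite_index_normal_core:
  assumes A: "finite_index_subgroup A G"
  obtains N where "N \<lhd> G" "finite_index_subgroup N G" "N \<subseteq> A"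
proof -
  have sA: "subgroup A G" and fin: "finite (rcosets A)"
    using A by (auto simp: finite_index_subgroup_def)
  let ?N = "{n \<in> carrier G. \<forall>x\<in>carrier G. x \<otimes> n \<otimes> inv x \<in> A}"
  have sN: "subgroup ?N G"
  proof (rule subgroupI)
    show "?N \<noteq> {}"
      using subgroup.one_closed[OF sA] by (auto intro!: exI[of _ \<one>])
    show "inv n \<in> ?N" if n: "n \<in> ?N" for n
    proof -
      have "x \<otimes> inv n \<otimes> inv x \<in> A" if x: "x \<in> carrier G" for x
      proof -
        have "x \<otimes> inv n \<otimes> inv x = inv (x \<otimes> n \<otimes> inv x)"
          using n x by (simp add: inv_mult_group m_assoc)
        then show ?thesis
          using n x subgroup.m_inv_closed[OF sA] by simp
      qed
      then show ?thesis using n by simp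
    qed
    show "m \<otimes> n \<in> ?N" if m: "m \<in> ?N" and n: "n \<in> ?N" for m n
    proof -
      have "x \<otimes> (m \<otimes> n) \<otimes> inv x \<in> A" if x: "x \<in> carrier G" for x
      proof -
        have "inv x \<otimes> (x \<otimes> (n \<otimes> inv x)) = n \<otimes> inv x"
          using n x by (simp add: m_assoc[symmetric])
        then have "x \<otimes> (m \<otimes> n) \<otimes> inv x = (x \<otimes> m \<otimes> inv x) \<otimes> (x \<otimes> n \<otimes> inv x)"
          using m n x by (simp add: m_assoc)
        then show ?thesis
          using m n x subgroup.m_closed[OF sA] by simp
      qed
      then show ?thesis using m n by simp
    qed
  qed auto
  have "x \<otimes> n \<otimes> inv x \<in> ?N" if x: "x \<in> carrier G" and n: "n \<in> ?N" for x n
  proof -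
    have "y \<otimes> (x \<otimes> n \<otimes> inv x) \<otimes> inv y \<in> A" if y: "y \<in> carrier G" for y
    proof -
      have "y \<otimes> (x \<otimes> n \<otimes> inv x) \<otimes> inv y = (y \<otimes> x) \<otimes> n \<otimes> inv (y \<otimes> x)"
        using x y n by (simp add: inv_mult_group m_assoc)
      then show ?thesis using n x y by simp
    qed
    then show ?thesis using x n by simp
  qed
  then have normal: "?N \<lhd> G"
    using sN by (intro normal_invI)
  \<comment> \<open>Restriction makes the action a member of a finite function space, so that finitely many
    elements of \<open>G\<close> already realise all its values.\<close>
  let ?act = "\<lambda>g. restrict (\<lambda>C. C #> g) (rcosets A)"
  have "C #> g \<in> rcosets A" if C: "C \<in> rcosets A" and g: "g \<in> carrier G" for C g
  proof -
    obtain x where "x \<in> carrier G" "C = A #> x"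
      using C by (auto simp: RCOSETS_def)
    then have "C #> g = A #> (x \<otimes> g)"
      using g subgroup.subset[OF sA] by (simp add: coset_mult_assoc)
    then show ?thesis
      using \<open>x \<in> carrier G\<close> g subgroup.subset[OF sA] by (simp add: rcosetsI)
  qed
  then have "?act ` carrier G \<subseteq> (rcosets A) \<rightarrow>\<^sub>E (rcosets A)"
    by (simp add: image_subset_iff)
  then have "finite (?act ` carrier G)"
    using fin finite_PiE[of "rcosets A" "\<lambda>_. rcosets A"] finite_subset by blast
  from finite_subset_image[OF this order_refl]
  obtain F where F: "F \<subseteq> carrier G" "finite F" "?act ` carrier G = ?act ` F"
    by (elim exE conjE)
  have "g \<in> ?N <#> F" if g: "g \<in> carrier G" for g
  proof -
    obtain f where f: "f \<in> F" "?act g = ?act f"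
      using F(3) g by blast
    have fG: "f \<in> carrier G" using f(1) F(1) by blast
    have "x \<otimes> (g \<otimes> inv f) \<otimes> inv x \<in> A" if x: "x \<in> carrier G" for x
    proof -
      have "A #> x \<in> rcosets A"
        using x subgroup.subset[OF sA] by (rule_tac rcosetsI)
      then have "(A #> x) #> g = (A #> x) #> f"
        using fun_cong[OF f(2), of "A #> x"] by simp
      then have "A #> (x \<otimes> g) = A #> (x \<otimes> f)"
        using x g fG subgroup.subset[OF sA] by (simp add: coset_mult_assoc)
      then have "A #> ((x \<otimes> g) \<otimes> inv (x \<otimes> f)) = A"
        using x g fG subgroup.subset[OF sA] by (intro coset_mult_inv2) auto
      then have "(x \<otimes> g) \<otimes> inv (x \<otimes> f) \<in> A"
        using coset_join1[OF _ _ sA] x g fG by simp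
      then show ?thesis
        using x g fG by (simp add: inv_mult_group m_assoc)
    qed
    then have "g \<otimes> inv f \<in> ?N" using g fG by simp
    moreover have "g = (g \<otimes> inv f) \<otimes> f"
      using g fG by (simp add: m_assoc)
    ultimately show ?thesis
      using f(1) by (auto simp: set_mult_def)
  qed
  then have "finite_index_subgroup ?N G"
    using finite_index_iff_finite_cover[OF sN] F(1,2) by blast
  moreover have "?N \<subseteq> A"
    by (auto dest: bspec[of _ _ \<one>])
  ultimately show thesis
    using that normal by blast
qed

text \<open>
  Schreier's argument: let \<open>T\<close> be a finite set meeting all cosets of \<open>A\<close>, and \<open>B\<close> the subgroup generated
  by the elements \<open>t s u\<^sup>-\<^sup>1\<close> of \<open>A\<close> with \<open>t, u \<in> T\<close> and \<open>s\<close> a generator of \<open>G\<close> or the inverse of one.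
  Then \<open>B T\<close> is stable under right multiplication by generators, whence \<open>B T = G\<close>. To conclude
  \<open>B = A\<close> without requiring \<open>T\<close> to meet \<open>A\<close> only in \<open>\<one>\<close>, the elements of \<open>T \<inter> A\<close> are also taken
  as generators of \<open>B\<close>.
\<close>

lemma (in group) fg_finite_index_subgroup:
  assumes S: "finite S" "S \<subseteq> carrier G" "carrier G = generate G S"
    and A: "finite_index_subgroup A G"
  obtains Y where "finite Y" "Y \<subseteq> A" "A = generate G Y"
proof -
  have sA: "subgroup A G"
    using A by (simp add: finite_index_subgroup_def)
  obtain F where F: "finite F" "F \<subseteq> carrier G" "carrier G \<subseteq> A <#> F"
    using A finite_index_iff_finite_cover[OF sA] by blast
  let ?S = "S \<union> m_inv G ` S"
  let ?T = "insert \<one> F"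
  let ?Y = "A \<inter> (?T \<union> (\<lambda>(t, s, u). t \<otimes> s \<otimes> inv u) ` (?T \<times> ?S \<times> ?T))"
  have TG: "?T \<subseteq> carrier G" and SG: "?S \<subseteq> carrier G"
    using F(2) S(2) by auto
  have Y: "finite ?Y" "?Y \<subseteq> A"
    using F(1) S(1) by auto
  then have YG: "?Y \<subseteq> carrier G"
    using subgroup.subset[OF sA] by blast
  let ?B = "generate G ?Y"
  have sB: "subgroup ?B G"
    using YG by (rule generate_is_subgroup)
  have step: "g \<otimes> s \<in> ?B <#> ?T" if g: "g \<in> ?B <#> ?T" and s: "s \<in> ?S" for g s
  proof -
    obtain b t where bt: "b \<in> ?B" "t \<in> ?T" "g = b \<otimes> t"
      using g by (auto simp: set_mult_def)
    have G: "b \<in> carrier G" "t \<in> carrier G" "s \<in> carrier G"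
      using bt TG SG s subgroup.mem_carrier[OF sB] by auto
    then have "t \<otimes> s \<in> A <#> F"
      using F(3) by (meson m_closed subsetD)
    then obtain a u where u: "a \<in> A" "u \<in> F" "t \<otimes> s = a \<otimes> u"
      by (auto simp: set_mult_def)
    have uG: "u \<in> carrier G" and aG: "a \<in> carrier G"
      using u F(2) subgroup.mem_carrier[OF sA] by auto
    have "a = t \<otimes> s \<otimes> inv u"
      using u(3) uG aG G by (simp add: inv_solve_right)
    then have "a \<in> (\<lambda>(t, s, u). t \<otimes> s \<otimes> inv u) ` (?T \<times> ?S \<times> ?T)"
      using u(2) bt(2) s by (intro image_eqI[of _ _ "(t, s, u)"]) (simp, blast)
    then have "a \<in> ?Y"
      using u(1) by blast
    then have "b \<otimes> a \<in> ?B"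
      by (rule subgroup.m_closed[OF sB bt(1) generate.incl])
    moreover have "g \<otimes> s = (b \<otimes> a) \<otimes> u"
      using bt(3) u(3) G uG aG by (simp add: m_assoc)
    ultimately show ?thesis
      using u(2) unfolding set_mult_def by blast
  qed
  have all: "h \<in> generate G S \<Longrightarrow> g \<in> ?B <#> ?T \<Longrightarrow> g \<otimes> h \<in> ?B <#> ?T" for g h
  proof (induction arbitrary: g rule: generate.induct)
    case one
    then show ?case
      using set_mult_closed[OF subgroup.subset[OF sB] TG] by auto
  next
    case (eng h1 h2)
    have "h1 \<in> carrier G" "h2 \<in> carrier G"
      using eng S(3) by auto
    moreover have "g \<in> carrier G"
      using eng.prems set_mult_closed[OF subgroup.subset[OF sB] TG] by blast
    ultimately show ?case
      using eng.IH(2)[OF eng.IH(1)[OF eng.prems]] by (simp add: m_assoc)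
  qed (use step in auto)
  have "\<one> \<in> ?B <#> ?T"
    using subgroup.one_closed[OF sB] by (force simp: set_mult_def)
  then have cover: "g \<in> ?B <#> ?T" if "g \<in> carrier G" for g
    using all[of g \<one>] that S(3) by simp
  have BA: "?B \<subseteq> A"
    using Y(2) sA by (rule generate_subgroup_incl)
  have "a \<in> ?B" if a: "a \<in> A" for a
  proof -
    obtain b t where bt: "b \<in> ?B" "t \<in> ?T" "a = b \<otimes> t"
      using cover[of a] a subgroup.mem_carrier[OF sA] by (auto simp: set_mult_def)
    then have G: "b \<in> carrier G" "t \<in> carrier G" "a \<in> carrier G"
      using TG a subgroup.mem_carrier[OF sA] subgroup.mem_carrier[OF sB] by auto
    have "t = inv b \<otimes> a"
      using bt(3) G by (simp add: inv_solve_left)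
    then have "t \<in> A"
      using a bt(1) BA sA by (auto intro!: subgroup.m_closed subgroup.m_inv_closed)
    then have "t \<in> ?B"
      using bt(2) by (intro generate.incl) auto
    then show ?thesis
      using bt subgroup.m_closed[OF sB] by simp
  qed
  then have "A = ?B" using BA by blast
  then show thesis using that Y by blast
qed

section \<open>Subgroups of finitely generated abelian groups\<close>

text \<open>
  A new generator \<open>s\<close> with \<open>s\<^sup>k \<in> N\<close> contributes only the factors \<open>s\<^sup>i\<close> with \<open>0 \<le> i < k\<close>, since
  powers of \<open>s\<^sup>k\<close> can be moved into \<open>N\<close>.
\<close>

lemma (in comm_group) finite_cover_of_torsion_generators:
  assumes N: "subgroup N G" and S: "finite S" "S \<subseteq> carrier G"
    and torsion: "\<And>s. s \<in> S \<Longrightarrow> \<exists>k::int. k > 0 \<and> s [^] k \<in> N"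
  shows "\<exists>F. finite F \<and> F \<subseteq> carrier G \<and> generate G S \<subseteq> N <#> F"
  using S torsion
proof (induction S rule: finite_induct)
  case empty
  show ?case
    using subgroup.one_closed[OF N]
    by (intro exI[of _ "{\<one>}"]) (auto simp: generate_empty set_mult_def intro!: bexI[of _ \<one>])
next
  case (insert s S)
  obtain F where F: "finite F" "F \<subseteq> carrier G" "generate G S \<subseteq> N <#> F"
    using insert by auto
  obtain k :: int where k: "k > 0" "s [^] k \<in> N"
    using insert.prems(2) by blast
  have s: "s \<in> carrier G" and S: "S \<subseteq> carrier G"
    using insert.prems(1) by auto
  let ?E = "(\<lambda>i::int. s [^] i) ` {0..<k}"
  have "subgroup (generate G S <#> generate G {s}) G"
    using s S by (intro mult_subgroups generate_is_subgroup) auto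
  moreover have "insert s S \<subseteq> generate G S <#> generate G {s}"
  proof
    fix u assume "u \<in> insert s S"
    then consider "u = s" | "u \<in> S" by blast
    then show "u \<in> generate G S <#> generate G {s}"
    proof cases
      case 1
      then have "u = \<one> \<otimes> s" using s by simp
      then show ?thesis
        using generate.one[of G S] generate.incl[of s "{s}" G] unfolding set_mult_def by blast
    next
      case 2
      then have "u = u \<otimes> \<one>" using S by auto
      then show ?thesis
        using generate.one[of G "{s}"] generate.incl[OF 2, of G] unfolding set_mult_def by blast
    qed
  qed
  ultimately have "generate G (insert s S) \<subseteq> generate G S <#> generate G {s}"
    by (rule generate_subgroup_incl[rotated])
  moreover have "generate G S <#> generate G {s} \<subseteq> N <#> (F <#> ?E)"
  proof
    fix u assume "u \<in> generate G S <#> generate G {s}"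
    then obtain m and i :: int where u: "m \<in> generate G S" "u = m \<otimes> s [^] i"
      by (auto simp: set_mult_def generate_pow[OF s])
    obtain n f where nf: "n \<in> N" "f \<in> F" "m = n \<otimes> f"
      using u(1) F(3) by (force simp: set_mult_def)
    have G: "n \<in> carrier G" "f \<in> carrier G"
      using nf F(2) subgroup.mem_carrier[OF N] by auto
    have "s [^] i = s [^] (k * (i div k)) \<otimes> s [^] (i mod k)"
      using s by (simp flip: int_pow_mult)
    also have "s [^] (k * (i div k)) = (s [^] k) [^] (i div k)"
      using s by (simp add: int_pow_pow)
    finally have "u = (n \<otimes> (s [^] k) [^] (i div k)) \<otimes> (f \<otimes> s [^] (i mod k))"
      using u nf(3) G s by (simp add: m_ac)
    moreover have "n \<otimes> (s [^] k) [^] (i div k) \<in> N"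
      using nf(1) k(2) subgroup_int_pow_closed[OF N] subgroup.m_closed[OF N] by blast
    moreover have "f \<otimes> s [^] (i mod k) \<in> F <#> ?E"
      using nf(2) k(1) by (auto simp: set_mult_def intro!: bexI[of _ f] bexI[of _ "i mod k"])
    ultimately show "u \<in> N <#> (F <#> ?E)"
      unfolding set_mult_def by blast
  qed
  ultimately have "generate G (insert s S) \<subseteq> N <#> (F <#> ?E)"
    by blast
  moreover have "finite (F <#> ?E)"
    using F(1) by (simp add: set_mult_def)
  moreover have "F <#> ?E \<subseteq> carrier G"
    using F(2) s by (intro set_mult_closed) auto
  ultimately show ?case by blast
qed

lemma (in group) maximal_subgroup_avoiding:
  assumes L: "subgroup L G" and x: "x \<notin> L"
  obtains N where "subgroup N G" "L \<subseteq> N" "x \<notin> N"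
    "\<And>M. \<lbrakk>subgroup M G; N \<subseteq> M; x \<notin> M\<rbrakk> \<Longrightarrow> M = N"
proof -
  let ?F = "{N. subgroup N G \<and> L \<subseteq> N \<and> x \<notin> N}"
  have "\<exists>N\<in>?F. \<forall>M\<in>?F. N \<subseteq> M \<longrightarrow> M = N"
  proof (rule subset_Zorn_nonempty)
    show "?F \<noteq> {}" using assms by blast
    fix \<C> assume ne: "\<C> \<noteq> {}" and ch: "subset.chain ?F \<C>"
    then have sub: "\<And>C. C \<in> \<C> \<Longrightarrow> subgroup C G \<and> L \<subseteq> C \<and> x \<notin> C"
      by (auto simp: subset_chain_def)
    have "subgroup (\<Union>\<C>) G"
    proof (rule subgroupI)
      show "\<Union>\<C> \<subseteq> carrier G"
        using sub subgroup.subset by blast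
      show "\<Union>\<C> \<noteq> {}"
        using ne sub subgroup.one_closed by blast
      show "inv a \<in> \<Union>\<C>" if "a \<in> \<Union>\<C>" for a
        using that sub by (meson UnionE UnionI subgroup.m_inv_closed)
      fix a b assume "a \<in> \<Union>\<C>" "b \<in> \<Union>\<C>"
      then obtain C D where "C \<in> \<C>" "D \<in> \<C>" "a \<in> C" "b \<in> D" by blast
      moreover have "C \<subseteq> D \<or> D \<subseteq> C"
        using ch \<open>C \<in> \<C>\<close> \<open>D \<in> \<C>\<close> by (auto simp: subset_chain_def)
      ultimately show "a \<otimes> b \<in> \<Union>\<C>"
        using sub by (meson UnionI subgroup.m_closed subsetD)
    qed
    then show "\<Union>\<C> \<in> ?F"
      using sub ne by blast
  qed
  then obtain N where N: "N \<in> ?F" and max: "\<And>M. M \<in> ?F \<Longrightarrow> N \<subseteq> M \<Longrightarrow> M = N"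
    by meson
  show thesis
  proof (rule that)
    show "subgroup N G" "L \<subseteq> N" "x \<notin> N"
      using N by auto
    show "M = N" if "subgroup M G" "N \<subseteq> M" "x \<notin> M" for M
      using max[of M] that N by auto
  qed
qed

text \<open>
  If no positive power of \<open>a\<close> were in \<open>N\<close>, then by maximality \<open>x\<close> would be in \<open>N \<langle>a\<^sup>k\<rangle>\<close> for every
  \<open>k > 0\<close>. Write \<open>x \<in> N a\<^sup>m\<close>, where \<open>m \<noteq> 0\<close> because \<open>x \<notin> N\<close>. The exponent \<open>m\<close> is determined by \<open>x\<close>, so it
  would be divisible by every \<open>k > 0\<close>; already \<open>k = 2 \<bar>m\<bar>\<close> is impossible.
\<close>

lemma (in comm_group) torsion_mod_maximal_subgroup_avoiding:
  assumes N: "subgroup N G" "x \<notin> N"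
    and max: "\<And>M. \<lbrakk>subgroup M G; N \<subseteq> M; x \<notin> M\<rbrakk> \<Longrightarrow> M = N"
    and a: "a \<in> carrier G"
  shows "\<exists>k::int. k > 0 \<and> a [^] k \<in> N"
proof (rule ccontr)
  assume "\<not> ?thesis"
  then have pos: "a [^] k \<notin> N" if "k > 0" for k :: int
    using that by simp
  have nz: "a [^] k \<notin> N" if "k \<noteq> 0" for k :: int
  proof (cases "k > 0")
    case False
    then have "a [^] (- k) \<notin> N" using that by (intro pos) simp
    then show ?thesis
      using subgroup.m_inv_closed[OF N(1)] a by (auto simp: int_pow_neg)
  qed (rule pos)
  have dec: "\<exists>n\<in>N. \<exists>j::int. x = n \<otimes> a [^] (k * j)" if k: "k > 0" for k :: int
  proof -
    let ?M = "N <#> generate G {a [^] k}"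
    have M: "subgroup ?M G"
      using a by (intro mult_subgroups N(1) generate_is_subgroup) auto
    have NM: "N \<subseteq> ?M"
    proof
      fix n assume n: "n \<in> N"
      then have "n = n \<otimes> \<one>" using subgroup.mem_carrier[OF N(1)] by simp
      then show "n \<in> ?M"
        using n generate.one[of G "{a [^] k}"] unfolding set_mult_def by blast
    qed
    have "a [^] k = \<one> \<otimes> a [^] k" using a by simp
    then have "a [^] k \<in> ?M"
      using subgroup.one_closed[OF N(1)] generate.incl[of "a [^] k" "{a [^] k}" G]
      unfolding set_mult_def by blast
    then have "x \<in> ?M"
      using max[OF M NM] pos[OF k] by blast
    then show ?thesis
      using a by (auto simp: set_mult_def generate_pow int_pow_pow)
  qed
  obtain n m where n: "n \<in> N" "x = n \<otimes> a [^] (m::int)"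
    using dec[of 1] by auto
  have m: "m \<noteq> 0"
    using n N subgroup.mem_carrier[OF N(1)] by auto
  obtain n' j where n': "n' \<in> N" "x = n' \<otimes> a [^] (2 * \<bar>m\<bar> * (j::int))"
    using dec[of "2 * \<bar>m\<bar>"] m by auto
  let ?l = "2 * \<bar>m\<bar> * j"
  have G: "n \<in> carrier G" "n' \<in> carrier G" "a [^] m \<in> carrier G" "a [^] ?l \<in> carrier G"
    using n n' a subgroup.mem_carrier[OF N(1)] by auto
  have "a [^] (m - ?l) = a [^] m \<otimes> inv (a [^] ?l)"
    using a by (simp add: int_pow_diff)
  also have "\<dots> = inv n \<otimes> n'"
  proof -
    have "a [^] m = inv n \<otimes> (n' \<otimes> a [^] ?l)"
      using n(2) n'(2) G by (metis inv_solve_left m_closed)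
    then show ?thesis using G by (simp add: m_assoc)
  qed
  also have "\<dots> \<in> N"
    using n(1) n'(1) N(1) by (simp add: subgroup.m_closed subgroup.m_inv_closed)
  finally have "m - ?l = 0" using nz by blast
  then have "\<bar>m\<bar> = \<bar>m\<bar> * (2 * \<bar>j\<bar>)"
    by (metis abs_mult abs_abs abs_numeral eq_iff_diff_eq_0 mult.assoc mult.commute)
  then have "2 * \<bar>j\<bar> = 1" using m by simp
  then show False by presburger
qed

lemma (in comm_group) fg_abelian_subgroup_separable:
  assumes S: "finite S" "S \<subseteq> carrier G" "carrier G = generate G S"
    and L: "subgroup L G" "x \<notin> L"
  obtains N where "finite_index_subgroup N G" "L \<subseteq> N" "x \<notin> N"
proof -
  obtain N where N: "subgroup N G" "L \<subseteq> N" "x \<notin> N"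
    "\<And>M. \<lbrakk>subgroup M G; N \<subseteq> M; x \<notin> M\<rbrakk> \<Longrightarrow> M = N"
    using maximal_subgroup_avoiding[OF L] by blast
  have "\<exists>k::int. k > 0 \<and> s [^] k \<in> N" if "s \<in> S" for s
    using torsion_mod_maximal_subgroup_avoiding[OF N(1,3,4)] that S(2) by blast
  then have "finite_index_subgroup N G"
    using finite_cover_of_torsion_generators[OF N(1) S(1,2)] S(3)
      finite_index_iff_finite_cover[OF N(1)] by simp
  then show thesis using that N by blast
qed

section \<open>Finitely presented groups are finitely generated\<close>

lemma free_group_generated:
  "carrier (free_group X) = generate (free_group X) ((\<lambda>x. free_rel X `` {[(x, True)]}) ` X)"
proof -
  let ?F = "free_group X" and ?c = "\<lambda>w. free_rel X `` {w}"
  let ?S = "(\<lambda>x. ?c [(x, True)]) ` X"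
  interpret F: group ?F by (rule group_free_group)
  have cls: "?c w \<in> carrier ?F" if "w \<in> lists (X \<times> UNIV)" for w
    using that by (auto simp: free_group_def quotient_def)
  have SF: "?S \<subseteq> carrier ?F"
    using cls by auto
  have letter: "?c [(x, b)] \<in> generate ?F ?S" if x: "x \<in> X" for x b
  proof (cases b)
    case True
    then show ?thesis using x by (intro generate.incl) auto
  next
    case False
    have "free_eq X ([] @ [(x, False), (x, \<not> False)] @ []) ([] @ [])"
      using x by (intro free_eq.cancel) auto
    then have "?c ([(x, False)] @ [(x, True)]) = ?c []"
      by (intro equiv_class_eq[OF equiv_free_rel]) (simp add: free_rel_def)
    then have "?c [(x, False)] \<otimes>\<^bsub>?F\<^esub> ?c [(x, True)] = \<one>\<^bsub>?F\<^esub>"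
      using x by (subst free_group_mult_class) (auto simp: free_group_def)
    then have "inv\<^bsub>?F\<^esub> (?c [(x, True)]) = ?c [(x, False)]"
      using x by (intro F.inv_equality cls) auto
    then show ?thesis
      using x False generate.inv[of "?c [(x, True)]" ?S ?F] by auto
  qed
  have "?c w \<in> generate ?F ?S" if "w \<in> lists (X \<times> UNIV)" for w
    using that
  proof (induction w rule: list.induct)
    case Nil
    then show ?case
      using generate.one[of ?F ?S] by (simp add: free_group_def)
  next
    case (Cons l w)
    obtain x b where l: "l = (x, b)" by (cases l)
    have "?c ([l] @ w) = ?c [l] \<otimes>\<^bsub>?F\<^esub> ?c w"
      using Cons.prems by (intro free_group_mult_class[symmetric]) auto
    moreover have "?c [l] \<in> generate ?F ?S" "?c w \<in> generate ?F ?S"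
      using Cons letter l by auto
    ultimately show ?case
      using generate.eng[of "?c [l]" ?F ?S "?c w"] by simp
  qed
  then have "carrier ?F \<subseteq> generate ?F ?S"
    by (auto simp: free_group_def elim!: quotientE)
  then show ?thesis
    using F.generate_incl[OF SF] by blast
qed

lemma (in group) finitely_presented_imp_fg:
  assumes "finitely_presented G"
  obtains S where "finite S" "S \<subseteq> carrier G" "carrier G = generate G S"
proof -
  obtain X :: "nat set" and R where X: "finite X" "R \<subseteq> carrier (free_group X)"
    and iso: "G \<cong> free_group X Mod normal_closure (free_group X) R"
    using assms unfolding finitely_presented_def by blast
  let ?F = "free_group X" and ?N = "normal_closure (free_group X) R"
  interpret F: group ?F by (rule group_free_group)
  interpret N: normal ?N ?F
    using X(2) by (rule F.normal_normal_closure)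
  obtain \<phi> where \<phi>: "\<phi> \<in> iso (?F Mod ?N) G"
    using iso_sym[OF iso] by (auto simp: is_iso_def)
  let ?\<psi> = "\<phi> \<circ> (\<lambda>a. ?N #>\<^bsub>?F\<^esub> a)"
  have "?\<psi> \<in> hom ?F G"
    using \<phi> by (intro Group.hom_compose[OF N.r_coset_hom_Mod]) (simp add: iso_def)
  then interpret \<psi>: group_hom ?F G ?\<psi>
    by unfold_locales
  have "(\<lambda>a. ?N #>\<^bsub>?F\<^esub> a) ` carrier ?F = carrier (?F Mod ?N)"
    by (auto simp: FactGroup_def RCOSETS_def)
  then have surj: "?\<psi> ` carrier ?F = carrier G"
    using \<phi> unfolding image_comp[symmetric] by (simp add: iso_def bij_betw_def)
  let ?S = "(\<lambda>x. free_rel X `` {[(x, True)]}) ` X"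
  have SF: "?S \<subseteq> carrier ?F"
    unfolding free_group_generated by (blast intro: generate.incl)
  have "carrier G = ?\<psi> ` generate ?F ?S"
    using surj free_group_generated[of X] by simp
  also have "\<dots> = generate G (?\<psi> ` ?S)"
    using \<psi>.generate_img[OF SF] by simp
  finally show thesis
    using X(1) SF surj by (intro that[of "?\<psi> ` ?S"]) blast+
qed

section \<open>Closed cosets in the profinite topology\<close>

text \<open>
  If \<open>N \<supseteq> L\<close> omits \<open>y u\<^sup>-\<^sup>1\<close>, then \<open>N y\<close> and \<open>N u \<supseteq> L u\<close> are different cosets, so \<open>N y\<close> is an open
  neighbourhood of \<open>y\<close> disjoint from \<open>L u\<close>.
\<close>

lemma (in group) closedin_profinite_coset:
  assumes L: "subgroup L G" and u: "u \<in> carrier G"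
    and separable: "\<And>y. \<lbrakk>y \<in> carrier G; y \<notin> L\<rbrakk> \<Longrightarrow>
      \<exists>N. finite_index_subgroup N G \<and> L \<subseteq> N \<and> y \<notin> N"
  shows "closedin (profinite_topology G) (L #> u)"
proof -
  let ?C = "carrier G - (L #> u)"
  have "\<exists>U. openin (profinite_topology G) U \<and> y \<in> U \<and> U \<subseteq> ?C" if y: "y \<in> ?C" for y
  proof -
    have yG: "y \<in> carrier G" using y by blast
    have "y \<otimes> inv u \<notin> L"
    proof
      assume "y \<otimes> inv u \<in> L"
      moreover have "y = (y \<otimes> inv u) \<otimes> u"
        using yG u by (simp add: m_assoc)
      ultimately have "y \<in> L #> u"
        unfolding r_coset_def by blast
      then show False using y by blast
    qed
    then obtain N where N: "finite_index_subgroup N G" "L \<subseteq> N" "y \<otimes> inv u \<notin> N"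
      using separable[of "y \<otimes> inv u"] yG u by auto
    have sN: "subgroup N G"
      using N(1) by (simp add: finite_index_subgroup_def)
    have "finite_index_coset G (N #> y)"
      using N(1) yG by (auto simp: finite_index_coset_def)
    then have "openin (profinite_topology G) (N #> y)"
      unfolding openin_profinite by (simp add: arbitrary_def union_of_inc)
    moreover have "y \<in> N #> y"
      using rcos_self[OF yG sN] .
    moreover have "N #> y \<subseteq> ?C"
    proof
      fix z assume z: "z \<in> N #> y"
      have "z \<notin> L #> u"
      proof
        assume "z \<in> L #> u"
        then have "z \<in> N #> u"
          using N(2) by (auto simp: r_coset_def)
        then have "N #> y = N #> u"
          using z repr_independence[OF _ _ sN] yG u by metis
        then have "N #> (y \<otimes> inv u) = N"
          using yG u subgroup.subset[OF sN] by (intro coset_mult_inv2) auto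
        then show False
          using coset_join1[OF _ _ sN] yG u N(3) by simp
      qed
      then show "z \<in> ?C"
        using z r_coset_subset_G[OF subgroup.subset[OF sN] yG] by blast
    qed
    ultimately show ?thesis by blast
  qed
  then have "openin (profinite_topology G) ?C"
    using openin_subopen by metis
  then show ?thesis
    using r_coset_subset_G[OF subgroup.subset[OF L] u]
    by (simp add: closedin_def topspace_profinite)
qed

text \<open>
  An element outside \<open>A\<close> is separated from \<open>L\<close> by \<open>A\<close> itself. For an element of \<open>A\<close>, a subgroup of
  finite index in \<open>A\<close> has finite index in \<open>G\<close> as well.
\<close>

lemma (in group) subgroup_of_fg_abelian_separable:
  assumes A: "finite_index_subgroup A G" "comm_group (G\<lparr>carrier := A\<rparr>)"
    and S: "finite S" "S \<subseteq> A" "A = generate G S"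
    and L: "subgroup L G" "L \<subseteq> A" and y: "y \<notin> L"
  shows "\<exists>N. finite_index_subgroup N G \<and> L \<subseteq> N \<and> y \<notin> N"
proof (cases "y \<in> A")
  case True
  have sA: "subgroup A G"
    using A(1) by (simp add: finite_index_subgroup_def)
  interpret A: comm_group "G\<lparr>carrier := A\<rparr>" by (rule A(2))
  have "generate (G\<lparr>carrier := A\<rparr>) S = generate G S"
    using S(2) sA by (rule generate_consistent)
  then obtain N where "finite_index_subgroup N (G\<lparr>carrier := A\<rparr>)" "L \<subseteq> N" "y \<notin> N"
    using A.fg_abelian_subgroup_separable[of S L y] S y subgroup_incl[OF L(1) sA L(2)] by auto
  then show ?thesis
    using finite_index_subgroup_trans[OF A(1)] by blast
next
  case False
  then show ?thesis using A(1) L(2) by blast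
qed

section \<open>Conjugates of cosets\<close>

lemma (in comm_group) hom_difference:
  assumes "\<phi> \<in> hom G G"
  shows "(\<lambda>a. inv a \<otimes> \<phi> a) \<in> hom G G"
proof (rule homI)
  fix a b assume ab: "a \<in> carrier G" "b \<in> carrier G"
  then have "\<phi> a \<in> carrier G" "\<phi> b \<in> carrier G" "\<phi> (a \<otimes> b) = \<phi> a \<otimes> \<phi> b"
    using assms by (auto simp: hom_def)
  then show "inv (a \<otimes> b) \<otimes> \<phi> (a \<otimes> b) = (inv a \<otimes> \<phi> a) \<otimes> (inv b \<otimes> \<phi> b)"
    using ab by (simp add: inv_mult m_ac)
qed (use assms in \<open>auto simp: hom_def\<close>)

lemma (in group) conjugation_hom:
  assumes "t \<in> carrier G"
  shows "(\<lambda>a. t \<otimes> a \<otimes> inv t) \<in> hom G G"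
proof (rule homI)
  fix a b assume ab: "a \<in> carrier G" "b \<in> carrier G"
  have "inv t \<otimes> (t \<otimes> (b \<otimes> inv t)) = b \<otimes> inv t"
    using assms ab by (simp add: m_assoc[symmetric])
  then show "t \<otimes> (a \<otimes> b) \<otimes> inv t = (t \<otimes> a \<otimes> inv t) \<otimes> (t \<otimes> b \<otimes> inv t)"
    using assms ab by (simp add: m_assoc)
qed (use assms in simp)

text \<open>
  By \<open>a\<^sup>-\<^sup>1 m v a = m (a\<^sup>-\<^sup>1 \<cdot> v a v\<^sup>-\<^sup>1) v\<close>, the subgroup \<open>L\<close> is the product of \<open>M\<close> with the image of the
  endomorphism \<open>a \<mapsto> a\<^sup>-\<^sup>1 \<cdot> v a v\<^sup>-\<^sup>1\<close> of \<open>A\<close>. Normality of \<open>A\<close> makes this map well defined, and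
  commutativity makes it a homomorphism.
\<close>

lemma (in group) conjugates_of_coset_form_coset:
  assumes A: "A \<lhd> G" "comm_group (G\<lparr>carrier := A\<rparr>)"
    and M: "subgroup M G" "M \<subseteq> A" and v: "v \<in> carrier G"
  obtains L where "subgroup L G" "L \<subseteq> A"
    "{inv a \<otimes> (m \<otimes> v) \<otimes> a | a m. a \<in> A \<and> m \<in> M} = L #> v"
proof -
  let ?GA = "G\<lparr>carrier := A\<rparr>"
  interpret A: comm_group ?GA by (rule A(2))
  have sA: "subgroup A G"
    using A(1) by (rule normal_imp_subgroup)
  have AG: "a \<in> carrier G" if "a \<in> A" for a
    using that subgroup.mem_carrier[OF sA] by blast
  have "(\<lambda>a. v \<otimes> a \<otimes> inv v) \<in> hom ?GA ?GA"
    using conjugation_hom[OF v] A(1) AG v by (auto simp: hom_def normal_inv_iff)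
  then have "(\<lambda>a. inv\<^bsub>?GA\<^esub> a \<otimes> (v \<otimes> a \<otimes> inv v)) \<in> hom ?GA ?GA"
    using A.hom_difference by fastforce
  then interpret D: group_hom ?GA ?GA "\<lambda>a. inv\<^bsub>?GA\<^esub> a \<otimes> (v \<otimes> a \<otimes> inv v)"
    by unfold_locales
  let ?D = "(\<lambda>a. inv a \<otimes> (v \<otimes> a \<otimes> inv v)) ` A"
  have "?D = (\<lambda>a. inv\<^bsub>?GA\<^esub> a \<otimes> (v \<otimes> a \<otimes> inv v)) ` A"
    using m_inv_consistent[OF sA] by simp
  then have "subgroup ?D ?GA"
    using D.img_is_subgroup by simp
  then have sL: "subgroup (M <#> ?D) ?GA"
    using A.mult_subgroups[OF subgroup_incl[OF M(1) sA M(2)]] by simp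
  have eq: "inv a \<otimes> (m \<otimes> v) \<otimes> a = m \<otimes> (inv a \<otimes> (v \<otimes> a \<otimes> inv v)) \<otimes> v"
    if a: "a \<in> A" and m: "m \<in> M" for a m
  proof -
    have G: "a \<in> carrier G" "m \<in> carrier G" "inv a \<in> A" "m \<in> A"
      using a m M(2) AG subgroup.m_inv_closed[OF sA] by auto
    have "inv a \<otimes> m = m \<otimes> inv a"
      using A.m_comm[of "inv a" m] G by simp
    then have "inv a \<otimes> (m \<otimes> v) \<otimes> a = m \<otimes> inv a \<otimes> v \<otimes> a"
      using G v by (simp add: m_assoc[symmetric])
    also have "\<dots> = m \<otimes> (inv a \<otimes> (v \<otimes> a \<otimes> inv v)) \<otimes> v"
      using G v by (simp add: m_assoc)
    finally show ?thesis .
  qed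
  have "{inv a \<otimes> (m \<otimes> v) \<otimes> a | a m. a \<in> A \<and> m \<in> M}
      = {m \<otimes> (inv a \<otimes> (v \<otimes> a \<otimes> inv v)) \<otimes> v | a m. a \<in> A \<and> m \<in> M}"
    by (rule Collect_cong) (metis eq)
  also have "\<dots> = (M <#> ?D) #> v"
    unfolding set_mult_def r_coset_def by blast
  finally have "{inv a \<otimes> (m \<otimes> v) \<otimes> a | a m. a \<in> A \<and> m \<in> M} = (M <#> ?D) #> v" .
  then show thesis
    using that[of "M <#> ?D"] incl_subgroup[OF sA sL] subgroup.subset[OF sL] by simp
qed

text \<open>
  A conjugating element \<open>x\<close> is written as \<open>t\<^sup>-\<^sup>1 a\<close> with \<open>t \<in> T\<close> and \<open>a \<in> A\<close>, and an element of \<open>H g\<close> as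
  \<open>h f g\<close> with \<open>h \<in> H \<inter> A\<close> and \<open>f \<in> F\<close>. Conjugation by \<open>t\<^sup>-\<^sup>1\<close> sends \<open>H \<inter> A\<close> to another subgroup of
  \<open>A\<close> and \<open>f g\<close> to an element that depends only on \<open>t\<close> and \<open>f\<close>; what remains is conjugation by \<open>a\<close>.
\<close>

lemma (in group) conj_saturation_decomposition:
  assumes A: "A \<lhd> G" and T: "T \<subseteq> carrier G" "carrier G \<subseteq> A <#> T"
    and H: "subgroup H G" and F: "F \<subseteq> H" "H \<subseteq> (H \<inter> A) <#> F" and g: "g \<in> carrier G"
  shows "conj_saturation G (H #> g) =
    (\<Union>t\<in>T. \<Union>f\<in>F. {inv a \<otimes> (m \<otimes> (t \<otimes> (f \<otimes> g) \<otimes> inv t)) \<otimes> a | a m.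
       a \<in> A \<and> m \<in> (\<lambda>h. t \<otimes> h \<otimes> inv t) ` (H \<inter> A)})" (is "?L = ?R")
proof -
  have sA: "subgroup A G"
    using A by (rule normal_imp_subgroup)
  have AG: "\<And>a. a \<in> A \<Longrightarrow> a \<in> carrier G" and HG: "\<And>h. h \<in> H \<Longrightarrow> h \<in> carrier G"
    using subgroup.mem_carrier[OF sA] subgroup.mem_carrier[OF H] by auto
  have eq: "inv (inv t \<otimes> a) \<otimes> (h \<otimes> f \<otimes> g) \<otimes> (inv t \<otimes> a)
      = inv a \<otimes> ((t \<otimes> h \<otimes> inv t) \<otimes> (t \<otimes> (f \<otimes> g) \<otimes> inv t)) \<otimes> a"
    if "t \<in> carrier G" "a \<in> carrier G" "h \<in> carrier G" "f \<in> carrier G" for t a h f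
  proof -
    have "(t \<otimes> h \<otimes> inv t) \<otimes> (t \<otimes> (f \<otimes> g) \<otimes> inv t) = t \<otimes> (h \<otimes> (f \<otimes> g)) \<otimes> inv t"
      using that g conjugation_hom[of t] by (simp add: hom_def)
    then show ?thesis
      using that g by (simp add: m_assoc inv_mult_group)
  qed
  show ?thesis
  proof
    show "?L \<subseteq> ?R"
    proof
      fix z assume "z \<in> ?L"
      then obtain x h0 where x: "x \<in> carrier G" "h0 \<in> H" "z = inv x \<otimes> (h0 \<otimes> g) \<otimes> x"
        by (auto simp: conj_saturation_def r_coset_def)
      have "inv x \<in> A <#> T"
        using T(2) x(1) by auto
      then obtain b t where bt: "b \<in> A" "t \<in> T" "inv x = b \<otimes> t"
        by (auto simp: set_mult_def)
      have "h0 \<in> (H \<inter> A) <#> F"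
        using F(2) x(2) by blast
      then obtain h f where hf: "h \<in> H \<inter> A" "f \<in> F" "h0 = h \<otimes> f"
        by (auto simp: set_mult_def)
      have G: "b \<in> carrier G" "t \<in> carrier G" "h \<in> carrier G" "f \<in> carrier G"
        using bt hf T(1) F(1) AG HG by auto
      have "x = inv (inv x)" using x(1) by simp
      also have "\<dots> = inv t \<otimes> inv b"
        unfolding bt(3) using G by (simp add: inv_mult_group)
      finally have x': "x = inv t \<otimes> inv b" .
      have "z = inv (inv b) \<otimes> ((t \<otimes> h \<otimes> inv t) \<otimes> (t \<otimes> (f \<otimes> g) \<otimes> inv t)) \<otimes> inv b"
        using eq[of t "inv b" h f] G unfolding x(3) x' hf(3) by simp
      moreover have "inv b \<in> A"
        using bt(1) subgroup.m_inv_closed[OF sA] by blast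
      ultimately show "z \<in> ?R"
        using bt(2) hf(1,2) by blast
    qed
    show "?R \<subseteq> ?L"
    proof
      fix z assume "z \<in> ?R"
      then obtain t f a h where z: "t \<in> T" "f \<in> F" "a \<in> A" "h \<in> H \<inter> A"
        "z = inv a \<otimes> ((t \<otimes> h \<otimes> inv t) \<otimes> (t \<otimes> (f \<otimes> g) \<otimes> inv t)) \<otimes> a"
        by blast
      have G: "a \<in> carrier G" "t \<in> carrier G" "h \<in> carrier G" "f \<in> carrier G"
        using z T(1) F(1) AG HG by auto
      have "z = inv (inv t \<otimes> a) \<otimes> (h \<otimes> f \<otimes> g) \<otimes> (inv t \<otimes> a)"
        using eq[of t a h f] G z(5) by simp
      moreover have "h \<otimes> f \<otimes> g \<in> H #> g"
        using z(2,4) F(1) subgroup.m_closed[OF H] by (auto simp: r_coset_def)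
      moreover have "inv t \<otimes> a \<in> carrier G"
        using G by simp
      ultimately show "z \<in> ?L"
        unfolding conj_saturation_def by blast
    qed
  qed
qed

section \<open>Coset-generalized conjugacy separability\<close>

lemma (in group) closedin_conj_saturation_coset:
  assumes S: "finite S" "S \<subseteq> carrier G" "carrier G = generate G S"
    and virt: "virtually_abelian G"
    and H: "subgroup H G" and g: "g \<in> carrier G"
  shows "closedin (profinite_topology G) (conj_saturation G (H #> g))"
proof -
  obtain B where B: "finite_index_subgroup B G" "comm_group (G\<lparr>carrier := B\<rparr>)"
    using virt unfolding virtually_abelian_def by blast
  obtain A where A: "A \<lhd> G" "finite_index_subgroup A G" "A \<subseteq> B"
    using finite_index_normal_core[OF B(1)] .
  have sA: "subgroup A G"
    using A(1) by (rule normal_imp_subgroup)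
  have "a \<otimes> b = b \<otimes> a" if "a \<in> A" "b \<in> A" for a b
    using comm_groupE(4)[OF B(2), of a b] that A(3) by auto
  then have comm: "comm_group (G\<lparr>carrier := A\<rparr>)"
    using subgroup_imp_group[OF sA] by (intro group.group_comm_groupI) auto
  obtain Y where Y: "finite Y" "Y \<subseteq> A" "A = generate G Y"
    using fg_finite_index_subgroup[OF S A(2)] .
  obtain T where T: "finite T" "T \<subseteq> carrier G" "carrier G \<subseteq> A <#> T"
    using A(2) finite_index_iff_finite_cover[OF sA] by blast
  obtain F where F: "finite F" "F \<subseteq> H" "H \<subseteq> (H \<inter> A) <#> F"
    using finite_cover_subgroup_Int[OF A(2) H] .
  have "closedin (profinite_topology G)
      {inv a \<otimes> (m \<otimes> (t \<otimes> (f \<otimes> g) \<otimes> inv t)) \<otimes> a | a m.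
        a \<in> A \<and> m \<in> (\<lambda>h. t \<otimes> h \<otimes> inv t) ` (H \<inter> A)}" (is "closedin _ ?C")
    if t: "t \<in> T" and f: "f \<in> F" for t f
  proof -
    have tG: "t \<in> carrier G" and fG: "f \<in> carrier G"
      using t f T(2) F(2) subgroup.mem_carrier[OF H] by auto
    interpret t: group_hom G G "\<lambda>h. t \<otimes> h \<otimes> inv t"
      using conjugation_hom[OF tG] by unfold_locales
    have M: "subgroup ((\<lambda>h. t \<otimes> h \<otimes> inv t) ` (H \<inter> A)) G"
      by (rule t.subgroup_img_is_subgroup[OF subgroups_Inter_pair[OF H sA]])
    have MA: "(\<lambda>h. t \<otimes> h \<otimes> inv t) ` (H \<inter> A) \<subseteq> A"
      using A(1) tG by (auto simp: normal_inv_iff)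
    have v: "t \<otimes> (f \<otimes> g) \<otimes> inv t \<in> carrier G"
      using tG fG g by simp
    obtain L where L: "subgroup L G" "L \<subseteq> A" "?C = L #> (t \<otimes> (f \<otimes> g) \<otimes> inv t)"
      using conjugates_of_coset_form_coset[OF A(1) comm M MA v] .
    show ?thesis
      unfolding L(3) using L(1) v
      by (rule closedin_profinite_coset)
        (rule subgroup_of_fg_abelian_separable[OF A(2) comm Y L(1,2)])
  qed
  then show ?thesis
    unfolding conj_saturation_decomposition[OF A(1) T(2,3) H F(2,3) g]
    using T(1) F(1) by (auto intro!: closedin_Union)
qed

theorem corollary4p14:
  fixes G :: "('a, 'b) monoid_scheme"
  assumes "group G"
    and "finitely_presented G"
    and "virtually_abelian G"
  shows "coset_gen_conj_separable G"
proof -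
  interpret group G by (rule assms(1))
  obtain S where "finite S" "S \<subseteq> carrier G" "carrier G = generate G S"
    using finitely_presented_imp_fg[OF assms(2)] .
  then show ?thesis
    using closedin_conj_saturation_coset assms(3)
    by (auto simp: coset_gen_conj_separable_def fg_subgroup_def)
qed

end
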